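(* Let $0 < \varepsilon < 1$ and $0 < a < b$, and let $n$ be a positive integer. Let $X_1, \ldots, X_n$ be independent and identically distributed Poisson random variables with mean $\lambda \in [a,b]$, and let $\widehat{\lambda}_n = \frac{1}{n}\sum_{i=1}^n X_i$. Then the minimum of $\Pr\left\{ \frac{|\widehat{\lambda}_n - \lambda|}{\lambda} < \varepsilon \right\}$ with respect to $\lambda \in [a,b]$ is achieved at (an element of) the finite set $$\{a, b\} \cup \left\{ \tfrac{\ell}{n(1+\varepsilon)} \in (a,b) : \ell \in \mathbb{Z} \right\} \cup \left\{ \tfrac{\ell}{n(1-\varepsilon)} \in (a,b) : \ell \in \mathbb{Z} \right\},$$ which has less than $2n(b-a) + 4$ elements.
   Context: For each $\lambda$, the probability is computed under the assumption that $X_1,\ldots,X_n$ are i.i.d. Poisson with mean $\lambda$, i.e. $\Pr\{X_i = k\} = \frac{\lambda^k e^{-\lambda}}{k!}$ for $k = 0,1,\ldots$; so it is a function of $\lambda \in [a,b]$ with $n$ and $\varepsilon$ fixed. *)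

theory Defs
  imports "HOL-Probability.Probability"
begin

(* Meant for l > 0: poisson_pmf is unspecified at nonpositive rates. *)
definition iid_poisson :: "'w measure \<Rightarrow> ('i \<Rightarrow> 'w \<Rightarrow> nat) \<Rightarrow> 'i set \<Rightarrow> real \<Rightarrow> bool" where
  "iid_poisson M X I l \<longleftrightarrow>
     prob_space M \<and>
     prob_space.indep_vars M (\<lambda>_. count_space UNIV) X I \<and>
     (\<forall>i\<in>I. distr M (count_space UNIV) (X i) = measure_pmf (poisson_pmf l))"

definition sample_mean :: "nat \<Rightarrow> (nat \<Rightarrow> 'w \<Rightarrow> nat) \<Rightarrow> 'w \<Rightarrow> real" where
  "sample_mean n X w = (1 / real n) * (\<Sum>i=1..n. real (X i w))"

definition coverage_prob ::
    "'w measure \<Rightarrow> (nat \<Rightarrow> 'w \<Rightarrow> nat) \<Rightarrow> nat \<Rightarrow> real \<Rightarrow> real \<Rightarrow> real" where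
  "coverage_prob M X n \<epsilon> l =
     measure M {w \<in> space M. \<bar>sample_mean n X w - l\<bar> / l < \<epsilon>}"

definition critical_points :: "nat \<Rightarrow> real \<Rightarrow> real \<Rightarrow> real \<Rightarrow> real set" where
  "critical_points n \<epsilon> a b =
     {a, b}
     \<union> {x. x \<in> {a<..<b} \<and> (\<exists>k::int. x = real_of_int k / (real n * (1 + \<epsilon>)))}
     \<union> {x. x \<in> {a<..<b} \<and> (\<exists>k::int. x = real_of_int k / (real n * (1 - \<epsilon>)))}"

end

theory Submission
  imports Defs
begin

text \<open>
  The sum \<open>S\<close> of the sample is Poisson with mean \<open>n * \<lambda>\<close>, and the event says that \<open>S\<close> lies strictly
  between \<open>n * \<lambda> * (1 - \<epsilon>)\<close> and \<open>n * \<lambda> * (1 + \<epsilon>)\<close>. Between two neighbouring critical points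
  \<open>u < v\<close> the integers in this range form a fixed interval \<open>m < k \<le> j\<close>, and the derivative of
  \<open>\<theta> \<mapsto> P(m < S \<le> j)\<close> telescopes to the difference of the Poisson weights at \<open>m\<close> and \<open>j\<close>, which
  changes sign at most once, from plus to minus. Hence on \<open>(u, v)\<close> this function is at least the
  minimum of its values at \<open>u\<close> and \<open>v\<close>; since the inequalities are strict, these values are
  in turn at least the coverage probabilities at \<open>u\<close> and \<open>v\<close>.
\<close>

section \<open>Poisson weights and the law of the sample sum\<close>

text \<open>An explicit formula in place of the mass function of \<open>poisson_pmf\<close>: it can
  be differentiated in \<theta> and makes sense at \<theta> = 0, which is the mean of an empty
  sum.\<close>

definition poisson_weight :: "real \<Rightarrow> nat \<Rightarrow> real" where
  "poisson_weight \<theta> k = \<theta> ^ k / fact k * exp (- \<theta>)"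

lemma poisson_weight_nonneg: "0 \<le> \<theta> \<Longrightarrow> 0 \<le> poisson_weight \<theta> k"
  by (simp add: poisson_weight_def)

lemma poisson_weight_pos: "0 < \<theta> \<Longrightarrow> 0 < poisson_weight \<theta> k"
  by (simp add: poisson_weight_def)

text \<open>Once \<open>exp (- (\<alpha> + \<beta>)) / fact k\<close> is factored out, this is the
  binomial theorem.\<close>

lemma poisson_weight_convolution:
  "(\<Sum>j\<le>k. poisson_weight \<alpha> j * poisson_weight \<beta> (k - j)) = poisson_weight (\<alpha> + \<beta>) k"
proof -
  have "(\<Sum>j\<le>k. poisson_weight \<alpha> j * poisson_weight \<beta> (k - j))
      = (\<Sum>j\<le>k. of_nat (k choose j) * \<alpha> ^ j * \<beta> ^ (k - j) * (exp (- (\<alpha> + \<beta>)) / fact k))"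
    by (intro sum.cong) (auto simp: poisson_weight_def binomial_fact mult_exp_exp field_simps)
  also have "\<dots> = poisson_weight (\<alpha> + \<beta>) k"
    unfolding sum_distrib_right[symmetric] poisson_weight_def by (simp add: binomial_ring)
  finally show ?thesis .
qed

text \<open>Induction on \<open>I\<close>: the new variable is independent of the sum of the others,
  so the two laws convolve.\<close>

lemma (in prob_space) prob_sum_iid_poisson:
  fixes X :: "'i \<Rightarrow> 'a \<Rightarrow> nat"
  assumes "finite I" and "indep_vars (\<lambda>_. count_space UNIV) X I"
    and "\<And>i. i \<in> I \<Longrightarrow> distr M (count_space UNIV) (X i) = measure_pmf (poisson_pmf r)"
    and "0 < r"
  shows "prob {w \<in> space M. (\<Sum>i\<in>I. X i w) = k} = poisson_weight (real (card I) * r) k"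
  using assms
proof (induction I arbitrary: k rule: finite_induct)
  \<comment> \<open>\<open>poisson_weight 0\<close> is the point mass at 0, because
    \<open>0 ^ 0 = 1\<close>.\<close>
  case empty
  then show ?case by (simp add: poisson_weight_def prob_space power_0_left)
next
  case (insert i I)
  \<comment> \<open>The variables are cast to the reals because \<open>indep_vars_sum\<close> speaks
    of real random variables.\<close>
  have indep_real: "indep_vars (\<lambda>_. borel) (\<lambda>i w. real (X i w)) (insert i I)"
    using insert.prems(1) by (rule indep_vars_compose2) simp
  have indep: "indep_var borel (\<lambda>w. real (X i w)) borel (\<lambda>w. \<Sum>i\<in>I. real (X i w))"
    using indep_vars_sum[OF insert.hyps indep_real] .
  have rv: "random_variable (count_space UNIV) (X j)" if "j \<in> insert i I" for j
    using insert.prems(1) that by (auto simp: indep_vars_def)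
  have [measurable]: "random_variable borel (\<lambda>w. real (X i w))"
    "random_variable borel (\<lambda>w. \<Sum>i\<in>I. real (X i w))"
    using indep by (auto dest: indep_var_rv1 indep_var_rv2)
  have first: "prob {w \<in> space M. X i w = j} = poisson_weight r j" for j
  proof -
    have "prob {w \<in> space M. X i w = j} = measure (distr M (count_space UNIV) (X i)) {j}"
      using rv by (subst measure_distr) (auto intro!: arg_cong[where f = prob])
    then show ?thesis
      using insert.prems by (simp add: measure_pmf_single poisson_weight_def)
  qed
  have rest: "prob {w \<in> space M. (\<Sum>i\<in>I. X i w) = j} = poisson_weight (real (card I) * r) j" for j
    using insert.prems by (intro insert.IH) (auto intro: indep_vars_subset)
  \<comment> \<open>The event is split by the value \<open>j\<close> of \<open>X i\<close>. The
    natural subtraction \<open>k - j\<close> is exact there, since the union runs over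
    \<open>j \<le> k\<close> only.\<close>
  define E where "E j = {w \<in> space M. real (X i w) = real j \<and> (\<Sum>i\<in>I. real (X i w)) = real (k - j)}" for j
  have E_sets: "E j \<in> events" for j
    unfolding E_def by measurable
  have E_prob: "prob (E j) = poisson_weight r j * poisson_weight (real (card I) * r) (k - j)" for j
  proof -
    have "prob (E j) = prob ((\<lambda>w. (real (X i w), \<Sum>i\<in>I. real (X i w))) -` ({real j} \<times> {real (k - j)}) \<inter> space M)"
      by (auto simp: E_def intro!: arg_cong[where f = prob])
    also have "\<dots> = prob ((\<lambda>w. real (X i w)) -` {real j} \<inter> space M)
        * prob ((\<lambda>w. \<Sum>i\<in>I. real (X i w)) -` {real (k - j)} \<inter> space M)"
      by (rule indep_varD[OF indep]) auto
    also have "(\<lambda>w. real (X i w)) -` {real j} \<inter> space M = {w \<in> space M. X i w = j}"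
      by auto
    also have "(\<lambda>w. \<Sum>i\<in>I. real (X i w)) -` {real (k - j)} \<inter> space M
        = {w \<in> space M. (\<Sum>i\<in>I. X i w) = k - j}"
      by (auto simp flip: of_nat_sum)
    finally show ?thesis by (simp add: first rest)
  qed
  have "{w \<in> space M. (\<Sum>i\<in>insert i I. X i w) = k} = (\<Union>j\<in>{..k}. E j)"
    using insert.hyps by (auto simp: E_def simp flip: of_nat_sum)
  then have "prob {w \<in> space M. (\<Sum>i\<in>insert i I. X i w) = k} = prob (\<Union>j\<in>{..k}. E j)"
    by simp
  also have "\<dots> = (\<Sum>j\<le>k. prob (E j))"
  proof (rule finite_measure_finite_Union)
    show "disjoint_family_on E {..k}" by (auto simp: disjoint_family_on_def E_def)
  qed (use E_sets in auto)
  also have "\<dots> = poisson_weight (real (card (insert i I)) * r) k"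
    using insert.hyps by (simp add: E_prob poisson_weight_convolution algebra_simps)
  finally show ?case .
qed

section \<open>The coverage probability as a finite sum\<close>

text \<open>These are the values of the sample sum at which the relative error is below
  \<epsilon>.\<close>

definition covered :: "nat \<Rightarrow> real \<Rightarrow> real \<Rightarrow> nat set" where
  "covered n \<epsilon> l = {k. real n * l * (1 - \<epsilon>) < real k \<and> real k < real n * l * (1 + \<epsilon>)}"

lemma finite_covered: "finite (covered n \<epsilon> l)"
  by (rule finite_subset[of _ "{..nat \<lceil>real n * l * (1 + \<epsilon>)\<rceil>}"]) (auto simp: covered_def, linarith)

text \<open>The lower end has the form \<open>Suc m\<close> because 0 is never covered; this lets
  the derivative telescope.\<close>

lemma covered_eq_atLeastAtMost:
  assumes "0 < n" "0 < l" "0 < \<epsilon>" "\<epsilon> < 1"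
  obtains m j where "covered n \<epsilon> l = {Suc m..j}"
proof
  have pos: "0 < real n * l * (1 + \<epsilon>)" "0 < real n * l * (1 - \<epsilon>)"
    using assms by auto
  \<comment> \<open>Both bounds are strict, so the least integer is a floor plus 1 and the greatest
    a ceiling minus 1. Positivity of the bounds ensures that \<open>nat\<close> truncates
    nothing.\<close>
  have "real n * l * (1 - \<epsilon>) < real k \<longleftrightarrow> Suc (nat \<lfloor>real n * l * (1 - \<epsilon>)\<rfloor>) \<le> k" for k
    using pos(2) by linarith
  moreover have "real k < real n * l * (1 + \<epsilon>) \<longleftrightarrow> k \<le> nat (\<lceil>real n * l * (1 + \<epsilon>)\<rceil> - 1)" for k
    using pos(1) by linarith
  ultimately show "covered n \<epsilon> l = {Suc (nat \<lfloor>real n * l * (1 - \<epsilon>)\<rfloor>)..nat (\<lceil>real n * l * (1 + \<epsilon>)\<rceil> - 1)}"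
    by (auto simp: covered_def)
qed

text \<open>This removes the probability space: what remains is the study of finite sums of
  weights.\<close>

lemma coverage_prob_eq_sum:
  assumes "iid_poisson M X {1..n} l" "0 < l" "0 < n"
  shows "coverage_prob M X n \<epsilon> l = (\<Sum>k\<in>covered n \<epsilon> l. poisson_weight (real n * l) k)"
proof -
  interpret prob_space M
    using assms(1) by (simp add: iid_poisson_def)
  have indep: "indep_vars (\<lambda>_. count_space UNIV) X {1..n}"
    and distr: "\<And>i. i \<in> {1..n} \<Longrightarrow> distr M (count_space UNIV) (X i) = measure_pmf (poisson_pmf l)"
    using assms(1) by (auto simp: iid_poisson_def)
  define E where "E k = {w \<in> space M. (\<Sum>i\<in>{1..n}. X i w) = k}" for k
  have E_prob: "prob (E k) = poisson_weight (real n * l) k" for k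
    using prob_sum_iid_poisson[OF _ indep distr] assms by (simp add: E_def)
  have E_sets: "E k \<in> events" for k
    \<comment> \<open>Nonmeasurable sets have measure 0, whereas the weight is positive.\<close>
    using E_prob[of k] poisson_weight_pos[of "real n * l" k] assms measure_notin_sets[of "E k" M] by force
  have "\<bar>sample_mean n X w - l\<bar> / l < \<epsilon> \<longleftrightarrow> (\<Sum>i\<in>{1..n}. X i w) \<in> covered n \<epsilon> l" for w
    using assms(2,3)
    by (auto simp: sample_mean_def covered_def abs_less_iff field_simps simp flip: of_nat_sum)
  then have "{w \<in> space M. \<bar>sample_mean n X w - l\<bar> / l < \<epsilon>} = (\<Union>k\<in>covered n \<epsilon> l. E k)"
    by (auto simp: E_def)
  then have "coverage_prob M X n \<epsilon> l = prob (\<Union>k\<in>covered n \<epsilon> l. E k)"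
    by (simp add: coverage_prob_def)
  also have "\<dots> = (\<Sum>k\<in>covered n \<epsilon> l. prob (E k))"
  proof (rule finite_measure_finite_Union)
    show "disjoint_family_on E (covered n \<epsilon> l)" by (auto simp: disjoint_family_on_def E_def)
  qed (use E_sets finite_covered in auto)
  finally show ?thesis by (simp add: E_prob)
qed

section \<open>Sums of weights over a fixed interval, as functions of the mean\<close>

text \<open>Product rule. At \<open>k = 0\<close> the formula would give 0, while the derivative is
  \<open>- exp (- \<theta>)\<close>.\<close>

lemma poisson_weight_has_derivative:
  assumes "0 < k"
  shows "((\<lambda>\<theta>. poisson_weight \<theta> k) has_real_derivative
    poisson_weight \<theta> (k - 1) - poisson_weight \<theta> k) (at \<theta>)"
proof -
  obtain k' where k: "k = Suc k'" using assms gr0_implies_Suc by blast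
  have pow: "((\<lambda>\<theta>. \<theta> ^ Suc k') has_real_derivative real (Suc k') * \<theta> ^ k') (at \<theta>)"
    using DERIV_pow[of "Suc k'" \<theta>] by simp
  have exp: "((\<lambda>\<theta>. exp (- \<theta>)) has_real_derivative - exp (- \<theta>)) (at \<theta>)"
    by (auto intro!: derivative_eq_intros)
  have "real (Suc k') / fact (Suc k') = 1 / fact k'"
    by (simp del: of_nat_Suc)
  then have "real (Suc k') * \<theta> ^ k' / fact (Suc k') = \<theta> ^ k' / fact k'"
    by (metis mult.commute times_divide_eq_right mult.right_neutral)
  then show ?thesis
    using DERIV_mult[OF DERIV_cdivide[OF pow, of "fact (Suc k')"] exp]
    unfolding poisson_weight_def k by (auto elim!: DERIV_cong simp del: fact_Suc of_nat_Suc)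
qed

lemma sum_poisson_weight_has_derivative:
  assumes "m \<le> j"
  shows "((\<lambda>\<theta>. \<Sum>k\<in>{Suc m..j}. poisson_weight \<theta> k) has_real_derivative
    poisson_weight \<theta> m - poisson_weight \<theta> j) (at \<theta>)"
proof -
  have "((\<lambda>\<theta>. \<Sum>k\<in>{Suc m..j}. poisson_weight \<theta> k) has_real_derivative
      (\<Sum>k\<in>{Suc m..j}. poisson_weight \<theta> (k - 1) - poisson_weight \<theta> k)) (at \<theta>)"
    by (intro DERIV_sum poisson_weight_has_derivative) auto
  also have "(\<Sum>k\<in>{Suc m..j}. poisson_weight \<theta> (k - 1) - poisson_weight \<theta> k)
      = - (\<Sum>k\<in>{Suc m..j}. poisson_weight \<theta> k - poisson_weight \<theta> (k - 1))"
    by (simp flip: sum_negf)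
  finally show ?thesis
    using sum_telescope''[OF assms, of "poisson_weight \<theta>"] by simp
qed

text \<open>The weight at \<open>j\<close> divided by the weight at \<open>m\<close> is
  \<open>\<theta> ^ (j - m) * fact m / fact j\<close>, which is nondecreasing in \<theta>; once
  above 1 it stays there.\<close>

lemma poisson_weight_crossing:
  assumes "m \<le> j" "0 < x" "x \<le> y" "poisson_weight x m < poisson_weight x j"
  shows "poisson_weight y m < poisson_weight y j"
proof -
  have ratio: "poisson_weight \<theta> j = poisson_weight \<theta> m * (\<theta> ^ (j - m) * fact m / fact j)" for \<theta>
    using power_add[of \<theta> m "j - m"] assms(1) by (simp add: poisson_weight_def)
  have "1 < x ^ (j - m) * fact m / fact j"
    using assms(4) poisson_weight_pos[OF assms(2), of m] unfolding ratio[of x]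
    by (metis mult.right_neutral mult_less_cancel_left_pos)
  also have "\<dots> \<le> y ^ (j - m) * fact m / fact j"
    using assms by (intro divide_right_mono mult_right_mono power_mono) auto
  finally show ?thesis
    using poisson_weight_pos[of y m] assms(2,3) unfolding ratio[of y]
    by (metis less_le_trans mult.right_neutral mult_less_cancel_left_pos)
qed

text \<open>A value at \<open>x\<close> below both end values would, by the mean value theorem,
  force a negative derivative left of \<open>x\<close> and a positive one right of it, against
  \<open>poisson_weight_crossing\<close>.\<close>

lemma sum_poisson_weight_quasiconcave:
  assumes "0 < u" "u < x" "x < v"
  shows "min (\<Sum>k\<in>{Suc m..j}. poisson_weight u k) (\<Sum>k\<in>{Suc m..j}. poisson_weight v k)
    \<le> (\<Sum>k\<in>{Suc m..j}. poisson_weight x k)"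
\<comment> \<open>For \<open>j < m\<close> all the sums are empty.\<close>
proof (cases "m \<le> j")
  case True
  define F where "F \<theta> = (\<Sum>k\<in>{Suc m..j}. poisson_weight \<theta> k)" for \<theta>
  have F': "(F has_real_derivative poisson_weight \<theta> m - poisson_weight \<theta> j) (at \<theta>)" for \<theta>
    using sum_poisson_weight_has_derivative[OF True] by (simp add: F_def[abs_def])
  have "min (F u) (F v) \<le> F x"
  proof (rule ccontr)
    assume "\<not> ?thesis"
    then have less: "F x < F u" "F x < F v" by auto
    obtain y where y: "u < y" "y < x" "F x - F u = (x - u) * (poisson_weight y m - poisson_weight y j)"
      using MVT2[OF assms(2) F'] by blast
    obtain z where z: "x < z" "z < v" "F v - F x = (v - x) * (poisson_weight z m - poisson_weight z j)"
      using MVT2[OF assms(3) F'] by blast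
    have "(x - u) * (poisson_weight y m - poisson_weight y j) < 0"
      using y(3) less by linarith
    then have "poisson_weight y m < poisson_weight y j"
      using assms by (simp add: mult_less_0_iff)
    then have "poisson_weight z m < poisson_weight z j"
      using poisson_weight_crossing[OF True, of y z] y z assms by simp
    then have "(v - x) * (poisson_weight z m - poisson_weight z j) < 0"
      using assms by (simp add: mult_less_0_iff)
    then show False
      using z(3) less by linarith
  qed
  then show ?thesis by (simp add: F_def)
qed simp

section \<open>Covered integers near a critical point\<close>

lemma critical_points_lower:
  assumes "x \<in> {a<..<b}" "0 < n" "\<epsilon> < 1" "real n * x * (1 - \<epsilon>) = real k"
  shows "x \<in> critical_points n \<epsilon> a b"
proof -
  have "x = real_of_int (int k) / (real n * (1 - \<epsilon>))"
    by (intro eq_divide_imp) (use assms in \<open>auto simp: mult_ac\<close>)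
  then show ?thesis
    using assms(1) unfolding critical_points_def by blast
qed

lemma critical_points_upper:
  assumes "x \<in> {a<..<b}" "0 < n" "0 < \<epsilon>" "real n * x * (1 + \<epsilon>) = real k"
  shows "x \<in> critical_points n \<epsilon> a b"
proof -
  have "x = real_of_int (int k) / (real n * (1 + \<epsilon>))"
    by (intro eq_divide_imp) (use assms in \<open>auto simp: mult_ac\<close>)
  then show ?thesis
    using assms(1) unfolding critical_points_def by blast
qed

text \<open>As the parameter grows, an integer can be lost only at the lower end of the range, and
  that end meets an integer only at a critical point. The point \<open>u\<close> itself may be
  critical.\<close>

lemma covered_mono_right:
  assumes "0 < n" "0 < \<epsilon>" "\<epsilon> < 1" "a \<le> u" "u < l" "l < b"
    and no_critical: "{u<..l} \<inter> critical_points n \<epsilon> a b = {}"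
  shows "covered n \<epsilon> u \<subseteq> covered n \<epsilon> l"
proof
  fix k assume "k \<in> covered n \<epsilon> u"
  then have k: "real n * u * (1 - \<epsilon>) < real k" "real k < real n * u * (1 + \<epsilon>)"
    by (auto simp: covered_def)
  have "real n * u * (1 + \<epsilon>) \<le> real n * l * (1 + \<epsilon>)"
    using assms by (intro mult_right_mono mult_left_mono) auto
  moreover have "real n * l * (1 - \<epsilon>) < real k"
  proof (rule ccontr)
    assume neg: "\<not> ?thesis"
    \<comment> \<open>The parameter at which the lower end of the range equals
      \<open>k\<close>.\<close>
    define x where "x = real k / (real n * (1 - \<epsilon>))"
    have c: "0 < real n * (1 - \<epsilon>)" using assms(1,3) by simp
    have "u < x" "x \<le> l"
      using k(1) neg by (simp_all add: x_def pos_less_divide_eq[OF c] pos_divide_le_eq[OF c] mult_ac)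
    moreover have "real n * x * (1 - \<epsilon>) = real k"
      using c assms(1-3) by (auto simp: x_def)
    ultimately show False
      using critical_points_lower[of x a b n \<epsilon> k] no_critical assms by auto
  qed
  ultimately show "k \<in> covered n \<epsilon> l"
    using k(2) by (simp add: covered_def)
qed

text \<open>Mirror image: as the parameter decreases from \<open>v\<close>, an integer can be lost
  only at the upper end.\<close>

lemma covered_mono_left:
  assumes "0 < n" "0 < \<epsilon>" "\<epsilon> < 1" "a < l" "l < v" "v \<le> b"
    and no_critical: "{l..<v} \<inter> critical_points n \<epsilon> a b = {}"
  shows "covered n \<epsilon> v \<subseteq> covered n \<epsilon> l"
proof
  fix k assume "k \<in> covered n \<epsilon> v"
  then have k: "real n * v * (1 - \<epsilon>) < real k" "real k < real n * v * (1 + \<epsilon>)"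
    by (auto simp: covered_def)
  have "real n * l * (1 - \<epsilon>) \<le> real n * v * (1 - \<epsilon>)"
    using assms by (intro mult_right_mono mult_left_mono) auto
  moreover have "real k < real n * l * (1 + \<epsilon>)"
  proof (rule ccontr)
    assume neg: "\<not> ?thesis"
    define x where "x = real k / (real n * (1 + \<epsilon>))"
    have c: "0 < real n * (1 + \<epsilon>)" using assms(1,2) by simp
    have "l \<le> x" "x < v"
      using k(2) neg by (simp_all add: x_def pos_le_divide_eq[OF c] pos_divide_less_eq[OF c] mult_ac)
    moreover have "real n * x * (1 + \<epsilon>) = real k"
      using c assms(1-3) by (auto simp: x_def)
    ultimately show False
      using critical_points_upper[of x a b n \<epsilon> k] no_critical assms by auto
  qed
  ultimately show "k \<in> covered n \<epsilon> l"
    using k(1) by (simp add: covered_def)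
qed

section \<open>Counting the critical points\<close>

text \<open>Multiplication by \<open>c\<close> turns \<open>S\<close> into the integers strictly
  between \<open>c * a\<close> and \<open>c * b\<close>.\<close>

lemma card_scaled_integers:
  fixes a b c :: real
  assumes "0 < c" "a < b"
  defines "S \<equiv> {x. x \<in> {a<..<b} \<and> (\<exists>k::int. x = real_of_int k / c)}"
  shows "finite S" "real (card S) < c * (b - a) + 1"
proof -
  let ?I = "{\<lfloor>c * a\<rfloor> + 1..\<lceil>c * b\<rceil> - 1}"
  have sub: "S \<subseteq> (\<lambda>k. real_of_int k / c) ` ?I"
  proof
    fix x assume "x \<in> S"
    then obtain k :: int where k: "x = real_of_int k / c" "a < x" "x < b"
      by (auto simp: S_def)
    then have "real_of_int k = c * x" "c * a < c * x" "c * x < c * b"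
      using assms(1) by (simp_all only: mult_less_cancel_left_pos) simp
    then have "k \<in> ?I" by (auto, linarith+)
    then show "x \<in> (\<lambda>k. real_of_int k / c) ` ?I" using k(1) by blast
  qed
  then show "finite S" by (rule finite_subset) simp
  have "card S \<le> card ?I"
    using surj_card_le[OF _ sub] by simp
  \<comment> \<open>The cardinality of \<open>?I\<close> involves \<open>nat\<close>; this
    inequality keeps the bound valid under truncation at 0.\<close>
  moreover have "c * a < c * b"
    using assms by simp
  ultimately have "real (card S) < c * b - c * a + 1"
    by simp linarith
  then show "real (card S) < c * (b - a) + 1"
    by (simp add: right_diff_distrib)
qed

text \<open>The two families have scales \<open>n * (1 + \<epsilon>)\<close> and
  \<open>n * (1 - \<epsilon>)\<close>, so \<epsilon> cancels when their bounds are added.\<close>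

lemma card_critical_points:
  assumes "0 < \<epsilon>" "\<epsilon> < 1" "a < b" "0 < n"
  shows "finite (critical_points n \<epsilon> a b)"
    and "real (card (critical_points n \<epsilon> a b)) < 2 * real n * (b - a) + 4"
proof -
  let ?S = "\<lambda>c. {x. x \<in> {a<..<b} \<and> (\<exists>k::int. x = real_of_int k / c)}"
  have pos: "0 < real n * (1 + \<epsilon>)" "0 < real n * (1 - \<epsilon>)"
    using assms by auto
  note S = card_scaled_integers[OF pos(1) \<open>a < b\<close>] card_scaled_integers[OF pos(2) \<open>a < b\<close>]
  have eq: "critical_points n \<epsilon> a b = {a, b} \<union> ?S (real n * (1 + \<epsilon>)) \<union> ?S (real n * (1 - \<epsilon>))"
    by (simp add: critical_points_def)
  show "finite (critical_points n \<epsilon> a b)"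
    unfolding eq using S by blast
  have "card (critical_points n \<epsilon> a b)
      \<le> card {a, b} + card (?S (real n * (1 + \<epsilon>))) + card (?S (real n * (1 - \<epsilon>)))"
    unfolding eq by (meson add_le_mono card_Un_le le_refl le_trans)
  also have "card {a, b} = 2" using assms by simp
  finally have "real (card (critical_points n \<epsilon> a b))
      \<le> 2 + real (card (?S (real n * (1 + \<epsilon>)))) + real (card (?S (real n * (1 - \<epsilon>))))"
    by linarith
  also have "\<dots> < 2 + (real n * (1 + \<epsilon>) * (b - a) + 1) + (real n * (1 - \<epsilon>) * (b - a) + 1)"
    using S by linarith
  also have "\<dots> = 2 * real n * (b - a) + 4"
    by (simp add: algebra_simps)
  finally show "real (card (critical_points n \<epsilon> a b)) < 2 * real n * (b - a) + 4" .
qed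

section \<open>Reduction of the minimum to the critical points\<close>

text \<open>If \<open>l\<close> is not critical itself, one of the two critical points nearest to it
  on either side serves as \<open>c\<close>.\<close>

lemma sum_covered_ge_neighbouring_critical_points:
  assumes "0 < \<epsilon>" "\<epsilon> < 1" "0 < a" "a < b" "0 < n" "l \<in> {a..b}"
  defines "C \<equiv> \<lambda>l. \<Sum>k\<in>covered n \<epsilon> l. poisson_weight (real n * l) k"
  shows "\<exists>c\<in>critical_points n \<epsilon> a b. C c \<le> C l"
proof (cases "l \<in> critical_points n \<epsilon> a b")
  case False
  let ?T = "critical_points n \<epsilon> a b"
  have fin: "finite ?T" using card_critical_points assms by blast
  have ends: "a \<in> ?T" "b \<in> ?T" by (auto simp: critical_points_def)
  then have l: "a < l" "l < b"
    using False assms(6) by (auto simp: less_le)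
  define u where "u = Max (?T \<inter> {..<l})"
  define v where "v = Min (?T \<inter> {l<..})"
  have u: "u \<in> ?T \<inter> {..<l}" and v: "v \<in> ?T \<inter> {l<..}"
    unfolding u_def v_def using fin ends l by (auto intro!: Max_in Min_in simp del: Int_iff)
  have le_u: "t \<le> u" if "t \<in> ?T" "t < l" for t
    unfolding u_def using that fin by (intro Max_ge) auto
  have v_le: "v \<le> t" if "t \<in> ?T" "l < t" for t
    unfolding v_def using that fin by (intro Min_le) auto
  have bounds: "a \<le> u" "v \<le> b"
    using le_u v_le ends l by auto
  have sub_u: "covered n \<epsilon> u \<subseteq> covered n \<epsilon> l"
  proof (rule covered_mono_right[where a = a and b = b])
    show "{u<..l} \<inter> ?T = {}" using le_u False by (force simp: le_less)
  qed (use u bounds l assms(1-5) in auto)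
  have sub_v: "covered n \<epsilon> v \<subseteq> covered n \<epsilon> l"
  proof (rule covered_mono_left[where a = a and b = b])
    show "{l..<v} \<inter> ?T = {}" using v_le False by (force simp: le_less)
  qed (use v bounds l assms(1-5) in auto)
  \<comment> \<open>The index set is frozen at \<open>l\<close> and only the mean varies with
    \<open>t\<close>.\<close>
  define F where "F t = (\<Sum>k\<in>covered n \<epsilon> l. poisson_weight (real n * t) k)" for t
  obtain m j where mj: "covered n \<epsilon> l = {Suc m..j}"
    using covered_eq_atLeastAtMost[of n l \<epsilon>] l assms by auto
  have "min (F u) (F v) \<le> F l"
    unfolding F_def mj using u v bounds assms
    by (intro sum_poisson_weight_quasiconcave) auto
  \<comment> \<open>At \<open>u\<close> the two sums have the same nonnegative weights, and
    \<open>C\<close> has the smaller index set.\<close>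
  moreover have "C u \<le> F u"
    unfolding C_def F_def using sub_u finite_covered bounds assms
    by (intro sum_mono2 poisson_weight_nonneg) auto
  moreover have "C v \<le> F v"
    unfolding C_def F_def using sub_v finite_covered l v assms
    by (intro sum_mono2 poisson_weight_nonneg) auto
  moreover have "F l = C l" by (simp add: F_def C_def)
  ultimately have "C u \<le> C l \<or> C v \<le> C l" by linarith
  then show ?thesis using u v by blast
qed blast

theorem theorem2:
  fixes \<epsilon> a b :: real and n :: nat
    and M :: "real \<Rightarrow> 'w measure"
    and X :: "real \<Rightarrow> nat \<Rightarrow> 'w \<Rightarrow> nat"
  assumes "0 < \<epsilon>" "\<epsilon> < 1"
    and "0 < a" "a < b"
    and "0 < n"
    and "\<And>l. l \<in> {a..b} \<Longrightarrow> iid_poisson (M l) (X l) {1..n} l"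
  shows "(\<exists>m \<in> critical_points n \<epsilon> a b.
            is_arg_min (\<lambda>l. coverage_prob (M l) (X l) n \<epsilon> l) (\<lambda>l. l \<in> {a..b}) m)
       \<and> finite (critical_points n \<epsilon> a b)
       \<and> real (card (critical_points n \<epsilon> a b)) < 2 * real n * (b - a) + 4"
proof -
  let ?T = "critical_points n \<epsilon> a b"
  let ?P = "\<lambda>l. coverage_prob (M l) (X l) n \<epsilon> l"
  have T: "finite ?T" "real (card ?T) < 2 * real n * (b - a) + 4"
    using card_critical_points assms by blast+
  have T_sub: "?T \<subseteq> {a..b}" and "?T \<noteq> {}"
    using assms(4) by (auto simp: critical_points_def)
  have P_eq: "?P l = (\<Sum>k\<in>covered n \<epsilon> l. poisson_weight (real n * l) k)" if "l \<in> {a..b}" for l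
    using coverage_prob_eq_sum[OF assms(6)[OF that]] that assms by auto
  \<comment> \<open>A minimiser over the finite set of critical points; it is global because each
    \<open>l\<close> is dominated by some critical point.\<close>
  obtain m where m: "m \<in> ?T" "\<And>c. c \<in> ?T \<Longrightarrow> ?P m \<le> ?P c"
    using ex_is_arg_min_if_finite[OF T(1) \<open>?T \<noteq> {}\<close>, of ?P] by (auto simp: is_arg_min_linorder)
  have "?P m \<le> ?P l" if l: "l \<in> {a..b}" for l
  proof -
    obtain c where "c \<in> ?T" "?P c \<le> ?P l"
      using sum_covered_ge_neighbouring_critical_points[OF assms(1-5) l] P_eq l T_sub by auto
    then show ?thesis using m(2) order_trans by blast
  qed
  then have "is_arg_min ?P (\<lambda>l. l \<in> {a..b}) m"
    using m(1) T_sub by (auto simp: is_arg_min_linorder)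
  then show ?thesis using m(1) T by blast
qed

end
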